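(* Let $\mathcal{N}$ be an electrical network on $n\ge 2$ nodes with admittance matrix $Y$. (1) Suppose $\mathcal{N}$ is connected and all its branch admittances are nonnegative real numbers, such that when all branches with zero admittance are deleted the network remains connected. Then the common value $c(Y)$ of all first cofactors of $Y$ is a positive real number, and hence $Y$ has (maximal) rank $n-1$. (2) More generally, if the network obtained from $\mathcal{N}$ by deleting all zero-admittance branches has exactly $k$ connected components (an isolated node being counted as a component in its own right), then $Y$ has rank at most $n-k$, and $c(Y)=0$ if $k>1$. (3) In the situation of (2), a sufficient condition for $Y$ to have rank exactly $n-k$ is that all remaining branch admittances are positive real numbers.
   Context: A network has nodes $1,\dots,n$ and finitely many branches $\alpha$, each joining two distinct nodes (parallel branches allowed) and carrying a scalar (real or complex) admittance $y_\alpha$. Its admittance matrix $Y$ is the $n\times n$ matrix with $Y_{kk}$ equal to the sum of admittances of all branches incident with node $k$, and, for $j\ne k$, $Y_{jk}$ equal to minus the sum of admittances of all branches joining nodes $j$ and $k$ (zero if none). The first cofactors are $C_{j,k}(Y)=(-1)^{j+k}\det Y_{(j,k)}$, where $Y_{(j,k)}$ is $Y$ with row $j$ and column $k$ deleted. Since all row and column sums of $Y$ vanish, all first cofactors are equal; $c(Y)$ denotes their common value. *)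

theory Defs
  imports Complex_Main
    "Jordan_Normal_Form.Determinant"
    "Jordan_Normal_Form.DL_Rank"
begin

text \<open>
  The nodes of a network \<open>N\<close> are \<open>0, \<dots>, num_nodes N - 1\<close>, following the indexing of matrices.
  Shifting the indices down by one changes no cofactor, since \<open>(-1)\<^sup>j\<^sup>+\<^sup>k\<close> is unaffected when both
  \<open>j\<close> and \<open>k\<close> are shifted. Branches are identified by labels, so that parallel branches are
  possible; \<open>ends N b\<close> is the unordered pair of nodes joined by the branch \<open>b\<close>.
\<close>

record ('b, 'a) network =
  num_nodes :: nat
  branches :: "'b set"
  ends :: "'b \<Rightarrow> nat set"
  admittance :: "'b \<Rightarrow> 'a"

definition is_network :: "('b, 'a) network \<Rightarrow> bool" where
  "is_network N \<longleftrightarrow> finite (branches N) \<and>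
     (\<forall>b\<in>branches N. ends N b \<subseteq> {..<num_nodes N} \<and> card (ends N b) = 2)"

definition delete_zero :: "('b, 'a::zero) network \<Rightarrow> ('b, 'a) network" where
  "delete_zero N = N\<lparr>branches := {b \<in> branches N. admittance N b \<noteq> 0}\<rparr>"

definition adjacency :: "('b, 'a) network \<Rightarrow> (nat \<times> nat) set" where
  "adjacency N = {(j, k). \<exists>b\<in>branches N. ends N b = {j, k}}"

definition connected_network :: "('b, 'a) network \<Rightarrow> bool" where
  "connected_network N \<longleftrightarrow>
     (\<forall>j<num_nodes N. \<forall>k<num_nodes N. (j, k) \<in> (adjacency N)\<^sup>*)"

text \<open>Components are represented by their node sets; an isolated node gives a singleton class.\<close>

definition components :: "('b, 'a) network \<Rightarrow> nat set set" where
  "components N = {..<num_nodes N} // (adjacency N)\<^sup>*"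

definition admittance_matrix :: "('b, 'a::comm_ring_1) network \<Rightarrow> 'a mat" where
  "admittance_matrix N = mat (num_nodes N) (num_nodes N) (\<lambda>(j, k).
     if j = k then (\<Sum>b | b \<in> branches N \<and> k \<in> ends N b. admittance N b)
     else - (\<Sum>b | b \<in> branches N \<and> ends N b = {j, k}. admittance N b))"

text \<open>Existence for admittance matrices is shown in \<open>common_cofactor_eq\<close> below.\<close>

definition common_cofactor :: "'a::comm_ring_1 mat \<Rightarrow> 'a" where
  "common_cofactor A = (THE c. \<forall>j<dim_row A. \<forall>k<dim_col A. cofactor A j k = c)"

lemma admittance_matrix_carrier [simp]:
  "admittance_matrix N \<in> carrier_mat (num_nodes N) (num_nodes N)"
  by (simp add: admittance_matrix_def)

lemma admittance_matrix_sym: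
  "j < num_nodes N \<Longrightarrow> k < num_nodes N \<Longrightarrow>
    admittance_matrix N $$ (j, k) = admittance_matrix N $$ (k, j)"
  by (simp add: admittance_matrix_def insert_commute)

lemma admittance_matrix_row_sum:
  assumes N: "is_network N" and j: "j < num_nodes N"
  shows "(\<Sum>k<num_nodes N. admittance_matrix N $$ (j, k)) = 0"
proof -
  let ?n = "num_nodes N" and ?y = "admittance N"
  let ?S = "\<lambda>k. {b. b \<in> branches N \<and> ends N b = {j, k}}"
  have fin: "finite (branches N)" using N by (simp add: is_network_def)
  have U: "{b. b \<in> branches N \<and> j \<in> ends N b} = (\<Union>k\<in>{..<?n} - {j}. ?S k)" (is "?L = ?R")
  proof
    show "?L \<subseteq> ?R"
    proof
      fix b assume b: "b \<in> ?L"
      then have "card (ends N b) = 2" "ends N b \<subseteq> {..<?n}"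
        using N by (auto simp: is_network_def)
      then obtain p q where "ends N b = {p, q}" "p \<noteq> q" "p < ?n" "q < ?n"
        by (auto simp: card_2_iff)
      then show "b \<in> ?R" using b by (auto simp: insert_commute)
    qed
  qed auto
  have "(\<Sum>b | b \<in> branches N \<and> j \<in> ends N b. ?y b) = (\<Sum>k\<in>{..<?n} - {j}. \<Sum>b\<in>?S k. ?y b)"
    unfolding U by (rule sum.UNION_disjoint) (use fin in \<open>auto simp: doubleton_eq_iff\<close>)
  moreover have "(\<Sum>k<?n. admittance_matrix N $$ (j, k)) =
      admittance_matrix N $$ (j, j) + (\<Sum>k\<in>{..<?n} - {j}. admittance_matrix N $$ (j, k))"
    by (rule sum.remove) (use j in auto)
  moreover have "(\<Sum>k\<in>{..<?n} - {j}. admittance_matrix N $$ (j, k)) =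
      (\<Sum>k\<in>{..<?n} - {j}. - (\<Sum>b\<in>?S k. ?y b))"
    by (rule sum.cong) (use j in \<open>auto simp: admittance_matrix_def\<close>)
  ultimately show ?thesis
    using j by (simp add: admittance_matrix_def sum_negf)
qed

lemma cofactor_row_eq:
  fixes A :: "'a::idom mat"
  assumes A: "A \<in> carrier_mat n n" and s: "\<And>i. i < n \<Longrightarrow> (\<Sum>k<n. A $$ (i, k)) = 0"
    and j: "j < n" and k: "k < n" and l: "l < n"
  shows "cofactor A j k = cofactor A j l"
proof -
  let ?r = "\<lambda>c. (if c = k then 1 else 0) - (if c = l then 1 else 0) :: 'a"
  define B where "B = mat n n (\<lambda>(i, c). if i = j then ?r c else A $$ (i, c))"
  have B: "B \<in> carrier_mat n n" by (simp add: B_def)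
  have "B *\<^sub>v vec n (\<lambda>_. 1) = 0\<^sub>v n"
  proof (rule eq_vecI)
    fix i assume "i < dim_vec (0\<^sub>v n :: 'a vec)"
    then have i: "i < n" by simp
    have "(B *\<^sub>v vec n (\<lambda>_. 1)) $ i = (\<Sum>c<n. B $$ (i, c))"
      using B i by (auto simp: scalar_prod_def atLeast0LessThan intro!: sum.cong)
    also have "\<dots> = 0"
    proof (cases "i = j")
      case True
      then have "(\<Sum>c<n. B $$ (i, c)) = (\<Sum>c<n. ?r c)"
        using i by (intro sum.cong) (auto simp: B_def)
      then show ?thesis using k l by (simp add: sum_subtractf)
    next
      case False
      then have "(\<Sum>c<n. B $$ (i, c)) = (\<Sum>c<n. A $$ (i, c))"
        using i by (intro sum.cong) (auto simp: B_def)
      then show ?thesis using s i by simp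
    qed
    finally show "(B *\<^sub>v vec n (\<lambda>_. 1)) $ i = (0\<^sub>v n :: 'a vec) $ i" using i by simp
  qed (use B in simp)
  moreover have "vec n (\<lambda>_. 1) \<noteq> (0\<^sub>v n :: 'a vec)"
  proof
    assume "vec n (\<lambda>_. 1) = (0\<^sub>v n :: 'a vec)"
    then have "vec n (\<lambda>_. 1) $ j = (0\<^sub>v n :: 'a vec) $ j" by simp
    then show False using j by simp
  qed
  ultimately have "det B = 0"
    using det_0_iff_vec_prod_zero[OF B] by (metis vec_carrier)
  moreover have "det B = (\<Sum>c<n. B $$ (j, c) * cofactor B j c)"
    using B j by (rule laplace_expansion_row)
  moreover have "mat_delete B j c = mat_delete A j c" for c
    using A j by (auto simp: mat_delete_def B_def intro!: eq_matI)
  then have "cofactor B j c = cofactor A j c" for c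
    by (simp add: cofactor_def)
  moreover have "(\<Sum>c<n. B $$ (j, c) * cofactor A j c) = (\<Sum>c<n. ?r c * cofactor A j c)"
    using j by (intro sum.cong) (auto simp: B_def)
  moreover have "\<dots> = (\<Sum>c<n. (if c = k then cofactor A j c else 0)
      - (if c = l then cofactor A j c else 0))"
    by (intro sum.cong) auto
  ultimately show ?thesis using k l by (simp add: sum_subtractf)
qed

lemma cofactor_sym:
  assumes A: "A \<in> carrier_mat n n"
    and sym: "\<And>i c. i < n \<Longrightarrow> c < n \<Longrightarrow> A $$ (i, c) = A $$ (c, i)"
    and j: "j < n" and k: "k < n"
  shows "cofactor A j k = cofactor A k j"
proof -
  have T: "A\<^sup>T = A" using A by (intro eq_matI) (auto simp: sym)
  have "det (mat_delete A k j) = det ((mat_delete A k j)\<^sup>T)"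
    by (rule det_transpose[symmetric, where n = "n - 1"]) (use A in \<open>auto simp: mat_delete_def\<close>)
  also have "(mat_delete A k j)\<^sup>T = mat_delete A j k"
  proof (rule eq_matI)
    fix i c assume "i < dim_row (mat_delete A j k)" "c < dim_col (mat_delete A j k)"
    then show "(mat_delete A k j)\<^sup>T $$ (i, c) = mat_delete A j k $$ (i, c)"
      using A j k by (auto simp: mat_delete_def sym)
  qed (use A in \<open>auto simp: mat_delete_def\<close>)
  finally show ?thesis by (simp add: cofactor_def add.commute)
qed

lemma common_cofactor_eq:
  fixes N :: "('b, 'a::idom) network"
  assumes N: "is_network N" and j: "j < num_nodes N" and k: "k < num_nodes N"
  shows "cofactor (admittance_matrix N) j k = common_cofactor (admittance_matrix N)"
proof -
  let ?Y = "admittance_matrix N" and ?n = "num_nodes N"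
  have row: "cofactor ?Y i c = cofactor ?Y i d" if "i < ?n" "c < ?n" "d < ?n" for i c d
    by (rule cofactor_row_eq[OF admittance_matrix_carrier admittance_matrix_row_sum[OF N]])
      (use that in auto)
  have sym: "cofactor ?Y i c = cofactor ?Y c i" if "i < ?n" "c < ?n" for i c
    by (rule cofactor_sym[OF admittance_matrix_carrier admittance_matrix_sym])
      (use that in auto)
  have all: "cofactor ?Y i c = cofactor ?Y j k" if "i < ?n" "c < ?n" for i c
    using row[OF that j] sym[OF that(1) j] row[OF j that(1) k] by (rule trans[OF trans])
  have dim: "dim_row ?Y = ?n" "dim_col ?Y = ?n" by (simp_all add: admittance_matrix_def)
  have "common_cofactor ?Y = cofactor ?Y j k"
    unfolding common_cofactor_def dim
  proof (rule the_equality)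
    show "\<forall>i<?n. \<forall>c<?n. cofactor ?Y i c = cofactor ?Y j k"
      by (intro allI impI all)
    show "c = cofactor ?Y j k" if "\<forall>i<?n. \<forall>l<?n. cofactor ?Y i l = c" for c
      using that j k by blast
  qed
  then show ?thesis by simp
qed

end

theory Submission
  imports Defs "Jordan_Normal_Form.Char_Poly"
begin

text \<open>
  Choose for every branch \<open>b\<close> an order of its two ends, and let \<open>d\<^sub>b\<close> be the vector with entries \<open>1\<close> and
  \<open>-1\<close> there. The admittance matrix is then \<open>Y = \<Sum>\<^sub>b y\<^sub>b d\<^sub>b d\<^sub>b\<^sup>T\<close> (\<open>admittance_matrix_factorization\<close>), so that
  \<open>Y v\<close> depends only on the potential drops \<open>d\<^sub>b\<^sup>T v\<close>, and \<open>v\<^sup>T Y v = \<Sum>\<^sub>b y\<^sub>b (d\<^sub>b\<^sup>T v)\<^sup>2\<close> is the dissipated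
  energy. Deleting branches of zero admittance does not change \<open>Y\<close>, so all branches may be taken to have
  nonzero admittance.

  A vector that is constant on components has no drops and lies in the kernel of \<open>Y\<close>. Conversely,
  if all admittances are positive, a real kernel vector has zero energy and hence no drops
  (\<open>zero_energy_imp_componentwise_constant\<close>). A kernel vector over an arbitrary real normed field
  is reduced to real ones by applying \<open>\<real>\<close>-linear functionals to its entries
  (\<open>kernel_componentwise_constant\<close>).

  For the rank, pick one representative node in each of the \<open>k\<close> components. Subtracting from \<open>v\<close> the
  vector that carries on each component the value of \<open>v\<close> at its representative does not change \<open>Y v\<close>.
  So the \<open>n - k\<close> columns that belong to the other nodes span the column space, and they are independent
  when every kernel vector is constant on components (\<open>rank_admittance_matrix\<close>).

  For the cofactor, delete row and column \<open>0\<close>, that is, ground node \<open>0\<close>. If some component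
  avoids node \<open>0\<close>, the indicator of all such components is a kernel vector vanishing at \<open>0\<close>, so the grounded matrix
  is singular (\<open>common_cofactor_zero_if_disconnected\<close>). If the network is connected with positive
  admittances, the energy makes the grounded real matrix positive definite, so its
  determinant is positive (\<open>posdef_det_pos\<close>, \<open>common_cofactor_pos\<close>).
\<close>

section \<open>Matrices: positive definiteness and rank\<close>

text \<open>
  The characteristic polynomial of \<open>- A\<close> is monic and takes the value \<open>det A\<close> at \<open>0\<close>. It has no root
  \<open>t \<ge> 0\<close>, since an eigenvector \<open>w\<close> would give \<open>w \<bullet> (A w) = - t (w \<bullet> w) \<le> 0\<close>; so it is
  positive on \<open>[0, \<infinity>)\<close> by the intermediate value theorem.
\<close>

lemma posdef_det_pos:
  fixes A :: "real mat"
  assumes A: "A \<in> carrier_mat n n"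
    and pd: "\<And>w. w \<in> carrier_vec n \<Longrightarrow> w \<noteq> 0\<^sub>v n \<Longrightarrow> w \<bullet> (A *\<^sub>v w) > 0"
  shows "det A > 0"
proof -
  let ?p = "char_poly (- A)"
  have A': "- A \<in> carrier_mat n n" using A by simp
  have nonroot: "poly ?p t \<noteq> 0" if t: "t \<ge> 0" for t
  proof
    assume "poly ?p t = 0"
    then obtain w where w: "w \<in> carrier_vec n" "w \<noteq> 0\<^sub>v n" and ev: "(- A) *\<^sub>v w = t \<cdot>\<^sub>v w"
      using eigenvalue_root_char_poly[OF A', of t] A unfolding eigenvalue_def eigenvector_def
      by auto
    have "w \<bullet> (A *\<^sub>v w) = - (w \<bullet> ((- A) *\<^sub>v w))"
      using A w by (simp add: uminus_mult_mat_vec)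
    also have "\<dots> = - (t * (w \<bullet> w))" using w by (simp add: ev)
    also have "\<dots> \<le> 0"
      using t by (simp add: scalar_prod_def sum_nonneg)
    finally show False using pd[OF w] by simp
  qed
  have "det A = poly ?p 0"
    unfolding char_poly_matrix[OF A']
    by (rule arg_cong[where f = det]) (use A in \<open>auto simp: char_matrix_def intro!: eq_matI\<close>)
  moreover have "\<not> poly ?p 0 < 0"
  proof
    assume neg: "poly ?p 0 < 0"
    have lc: "lead_coeff ?p = 1" using degree_monic_char_poly[OF A'] by simp
    then obtain m where "\<And>x. x \<ge> m \<Longrightarrow> poly ?p x \<ge> 1"
      using poly_pinfty_gt_lc[of ?p] by auto
    then have "poly ?p (max m 1) \<ge> 1" by simp
    then have "poly ?p (max m 1) > 0" by linarith
    moreover have "0 < max m 1" by (simp add: less_max_iff_disj)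
    ultimately obtain x where "x > 0" "poly ?p x = 0"
      using poly_IVT_pos[of 0 "max m 1" ?p] neg by auto
    then show False using nonroot[of x] by simp
  qed
  ultimately show ?thesis using nonroot[of 0] by simp
qed

lemma (in vec_space) rank_eq_if_col_space_eq:
  "col_space A = col_space B \<Longrightarrow> rank A = rank B"
  by (simp add: rank_def col_space_def)

text \<open>
  Distinctness of the columns has to be shown separately, because \<open>lin_depE\<close> speaks of the set of columns: two equal
  columns give a difference of unit vectors in the kernel.
\<close>

lemma (in vec_space) rank_eq_if_injective:
  assumes B: "B \<in> carrier_mat n m"
    and inj: "\<And>w. w \<in> carrier_vec m \<Longrightarrow> B *\<^sub>v w = 0\<^sub>v n \<Longrightarrow> w = 0\<^sub>v m"
  shows "rank B = m"
proof -
  have "distinct (cols B)"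
  proof (rule ccontr)
    assume "\<not> distinct (cols B)"
    then obtain i j where ij: "i < m" "j < m" "i \<noteq> j" and eq: "col B i = col B j"
      using B by (auto simp: distinct_conv_nth)
    have "B *\<^sub>v (unit_vec m i - unit_vec m j) = 0\<^sub>v n"
    proof (rule eq_vecI)
      fix r assume r: "r < dim_vec (0\<^sub>v n :: 'a vec)"
      then have "B $$ (r, i) = B $$ (r, j)"
        using B ij arg_cong[OF eq, of "\<lambda>c. c $ r"] by simp
      then show "(B *\<^sub>v (unit_vec m i - unit_vec m j)) $ r = 0\<^sub>v n $ r"
        using B ij r by (simp add: scalar_prod_minus_distrib[of _ m])
    qed (use B in simp)
    then have "unit_vec m i - unit_vec m j = (0\<^sub>v m :: 'a vec)"
      by (intro inj) auto
    from arg_cong[OF this, of "\<lambda>v. v $ i"] show False using ij by simp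
  qed
  then show ?thesis
    using lin_indpt_full_rank[OF B] lin_depE[OF B] inj by metis
qed

text \<open>
  This turns the rank of \<open>A\<close> into statements about vectors supported on a set \<open>S\<close> of column indices: if
  these already produce all values of \<open>A\<close>, then the columns indexed by \<open>S\<close> span the column space, and
  if moreover no such vector except \<open>0\<close> is in the kernel, those columns are a basis of it.
\<close>

lemma (in vec_space) rank_column_selection:
  assumes A: "A \<in> carrier_mat n nc" and S: "S \<subseteq> {..<nc}"
    and spanning: "\<And>v. v \<in> carrier_vec nc \<Longrightarrow>
      \<exists>u\<in>carrier_vec nc. (\<forall>i<nc. i \<notin> S \<longrightarrow> u $ i = 0) \<and> A *\<^sub>v u = A *\<^sub>v v"
  shows "rank A \<le> card S"
    and "(\<And>u. u \<in> carrier_vec nc \<Longrightarrow> (\<And>i. i < nc \<Longrightarrow> i \<notin> S \<Longrightarrow> u $ i = 0) \<Longrightarrow>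
      A *\<^sub>v u = 0\<^sub>v n \<Longrightarrow> u = 0\<^sub>v nc) \<Longrightarrow> rank A = card S"
proof -
  let ?m = "card S"
  have fin: "finite S" using S finite_subset by blast
  then obtain f where f: "bij_betw f {..<?m} S"
    using ex_bij_betw_nat_finite atLeast0LessThan by metis
  define B where "B = mat n ?m (\<lambda>(i, j). A $$ (i, f j))"
  have B: "B \<in> carrier_mat n ?m" by (simp add: B_def)
  have restrict: "A *\<^sub>v u = B *\<^sub>v vec ?m (\<lambda>j. u $ f j)"
    if u: "u \<in> carrier_vec nc" and supp: "\<And>i. i < nc \<Longrightarrow> i \<notin> S \<Longrightarrow> u $ i = 0" for u
  proof (rule eq_vecI)
    fix i assume "i < dim_vec (B *\<^sub>v vec ?m (\<lambda>j. u $ f j))"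
    then have i: "i < n" using B by simp
    have "(A *\<^sub>v u) $ i = (\<Sum>k<nc. A $$ (i, k) * u $ k)"
      using A u i by (auto simp: scalar_prod_def atLeast0LessThan intro!: sum.cong)
    also have "\<dots> = (\<Sum>k\<in>S. A $$ (i, k) * u $ k)"
      by (rule sum.mono_neutral_right) (use S supp in auto)
    also have "\<dots> = (\<Sum>j<?m. A $$ (i, f j) * u $ f j)"
      by (rule sum.reindex_bij_betw[OF f, symmetric])
    also have "\<dots> = (B *\<^sub>v vec ?m (\<lambda>j. u $ f j)) $ i"
      using B i by (auto simp: B_def scalar_prod_def atLeast0LessThan intro!: sum.cong)
    finally show "(A *\<^sub>v u) $ i = (B *\<^sub>v vec ?m (\<lambda>j. u $ f j)) $ i" .
  qed (use A B in simp)
  have extend: "\<exists>u\<in>carrier_vec nc. (\<forall>i<nc. i \<notin> S \<longrightarrow> u $ i = 0) \<and> vec ?m (\<lambda>j. u $ f j) = w"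
    if w: "w \<in> carrier_vec ?m" for w
  proof (intro bexI conjI allI impI)
    let ?u = "vec nc (\<lambda>i. if i \<in> S then w $ inv_into {..<?m} f i else 0)"
    show "?u \<in> carrier_vec nc" by simp
    show "?u $ i = 0" if "i < nc" "i \<notin> S" for i using that by simp
    show "vec ?m (\<lambda>j. ?u $ f j) = w"
    proof (rule eq_vecI)
      fix j assume "j < dim_vec w"
      then have j: "j < ?m" using w by simp
      then have "f j \<in> S" using f by (auto simp: bij_betw_def)
      moreover from this have "f j < nc" using S by auto
      moreover have "inv_into {..<?m} f (f j) = j"
        using f j by (simp add: bij_betw_def)
      ultimately show "vec ?m (\<lambda>j. ?u $ f j) $ j = w $ j" using j by simp
    qed (use w in simp)
  qed
  have "col_space A = col_space B"
    unfolding col_space_eq[OF A] col_space_eq[OF B]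
  proof (intro Set.set_eqI iffI)
    fix y assume "y \<in> {y \<in> carrier_vec (dim_row A). \<exists>x\<in>carrier_vec (dim_col A). A *\<^sub>v x = y}"
    then obtain v where "v \<in> carrier_vec nc" "A *\<^sub>v v = y" using A by auto
    with spanning[of v] obtain u where "u \<in> carrier_vec nc" "A *\<^sub>v u = y"
      "\<And>i. i < nc \<Longrightarrow> i \<notin> S \<Longrightarrow> u $ i = 0" by auto
    then have "B *\<^sub>v vec ?m (\<lambda>j. u $ f j) = y" using restrict by simp
    then show "y \<in> {y \<in> carrier_vec (dim_row B). \<exists>x\<in>carrier_vec (dim_col B). B *\<^sub>v x = y}"
      using B by (auto intro!: bexI[of _ "vec ?m (\<lambda>j. u $ f j)"])
  next
    fix y assume "y \<in> {y \<in> carrier_vec (dim_row B). \<exists>x\<in>carrier_vec (dim_col B). B *\<^sub>v x = y}"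
    then obtain w where "w \<in> carrier_vec ?m" "B *\<^sub>v w = y" using B by auto
    with extend[of w] obtain u where "u \<in> carrier_vec nc" "A *\<^sub>v u = y"
      using restrict by metis
    then show "y \<in> {y \<in> carrier_vec (dim_row A). \<exists>x\<in>carrier_vec (dim_col A). A *\<^sub>v x = y}"
      using A by auto
  qed
  then have rank: "rank A = rank B" by (rule rank_eq_if_col_space_eq)
  show "rank A \<le> ?m" unfolding rank by (rule rank_le_nc[OF B])
  show "rank A = ?m"
    if inj: "\<And>u. u \<in> carrier_vec nc \<Longrightarrow> (\<And>i. i < nc \<Longrightarrow> i \<notin> S \<Longrightarrow> u $ i = 0) \<Longrightarrow>
      A *\<^sub>v u = 0\<^sub>v n \<Longrightarrow> u = 0\<^sub>v nc"
    unfolding rank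
  proof (rule rank_eq_if_injective[OF B])
    fix w assume w: "w \<in> carrier_vec ?m" and "B *\<^sub>v w = 0\<^sub>v n"
    moreover from extend[OF w] obtain u where u: "u \<in> carrier_vec nc"
      "\<And>i. i < nc \<Longrightarrow> i \<notin> S \<Longrightarrow> u $ i = 0" "vec ?m (\<lambda>j. u $ f j) = w" by blast
    ultimately have "u = 0\<^sub>v nc" using restrict[of u] by (intro inj) auto
    moreover have "f j < nc" if "j < ?m" for j
      using that f S by (auto simp: bij_betw_def)
    ultimately show "w = 0\<^sub>v ?m" using u(3) by (auto intro!: eq_vecI)
  qed
qed

section \<open>The admittance matrix in terms of potential drops\<close>

text \<open>
  Reversing a branch changes the sign both of its drop and of its incidence vector, which leaves the
  products below unchanged; so the order of the node numbers serves as orientation.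
\<close>

definition potential_drop :: "('b, 'a) network \<Rightarrow> 'c::ab_group_add vec \<Rightarrow> 'b \<Rightarrow> 'c" where
  "potential_drop N v b = v $ Min (ends N b) - v $ Max (ends N b)"

definition incidence :: "('b, 'a) network \<Rightarrow> 'b \<Rightarrow> nat \<Rightarrow> 'c::comm_ring_1" where
  "incidence N b j = (if j = Min (ends N b) then 1 else 0) - (if j = Max (ends N b) then 1 else 0)"

lemma ends_Min_Max:
  assumes "is_network N" and "b \<in> branches N"
  shows "ends N b = {Min (ends N b), Max (ends N b)}" "Min (ends N b) \<noteq> Max (ends N b)"
    "Min (ends N b) < num_nodes N" "Max (ends N b) < num_nodes N"
proof -
  have e: "ends N b \<subseteq> {..<num_nodes N}" "card (ends N b) = 2"
    using assms by (auto simp: is_network_def)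
  then obtain p q where pq: "ends N b = {p, q}" "p \<noteq> q" by (auto simp: card_2_iff)
  then show eq: "ends N b = {Min (ends N b), Max (ends N b)}"
    and "Min (ends N b) \<noteq> Max (ends N b)" by (auto simp: min_def max_def)
  show "Min (ends N b) < num_nodes N" "Max (ends N b) < num_nodes N"
    using e(1) eq by blast+
qed

lemma sum_incidence:
  fixes v :: "'c::comm_ring_1 vec"
  assumes "is_network N" and "b \<in> branches N"
  shows "(\<Sum>k<num_nodes N. incidence N b k * v $ k) = potential_drop N v b"
proof -
  have "incidence N b k * v $ k = (if k = Min (ends N b) then v $ k else 0)
      - (if k = Max (ends N b) then v $ k else 0)" for k
    by (simp add: incidence_def)
  then show ?thesis
    using ends_Min_Max(3,4)[OF assms] by (simp add: sum_subtractf potential_drop_def)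
qed

text \<open>
  On the diagonal the product of incidences is \<open>1\<close> exactly for the branches at the node. Off
  the diagonal it is \<open>-1\<close> exactly for the branches between the two nodes.
\<close>

lemma admittance_matrix_factorization:
  fixes N :: "('b, 'a::comm_ring_1) network"
  assumes N: "is_network N" and j: "j < num_nodes N" and k: "k < num_nodes N"
  shows "admittance_matrix N $$ (j, k) =
    (\<Sum>b\<in>branches N. admittance N b * incidence N b j * incidence N b k)"
proof (cases "j = k")
  case True
  have fin: "finite (branches N)" using N by (simp add: is_network_def)
  have "admittance_matrix N $$ (j, k) =
      (\<Sum>b\<in>branches N. if k \<in> ends N b then admittance N b else 0)"
    using True j fin by (simp add: admittance_matrix_def sum.inter_filter)
  also have "\<dots> = (\<Sum>b\<in>branches N. admittance N b * incidence N b j * incidence N b k)"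
  proof (rule sum.cong[OF refl])
    fix b assume "b \<in> branches N"
    from ends_Min_Max(1,2)[OF N this]
    have "k \<in> ends N b \<longleftrightarrow> k = Min (ends N b) \<or> k = Max (ends N b)"
      and "Min (ends N b) \<noteq> Max (ends N b)" by blast+
    then show "(if k \<in> ends N b then admittance N b else 0) =
        admittance N b * incidence N b j * incidence N b k"
      using True by (auto simp: incidence_def)
  qed
  finally show ?thesis .
next
  case False
  have fin: "finite (branches N)" using N by (simp add: is_network_def)
  have "admittance_matrix N $$ (j, k) =
      (\<Sum>b\<in>branches N. if ends N b = {j, k} then - admittance N b else 0)"
    using False j k fin by (simp add: admittance_matrix_def sum.inter_filter sum_negf[symmetric] if_distrib cong: if_cong)
  also have "\<dots> = (\<Sum>b\<in>branches N. admittance N b * incidence N b j * incidence N b k)"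
  proof (rule sum.cong[OF refl])
    fix b assume "b \<in> branches N"
    from ends_Min_Max(1,2)[OF N this]
    have "ends N b = {j, k} \<longleftrightarrow> j = Min (ends N b) \<and> k = Max (ends N b) \<or>
        j = Max (ends N b) \<and> k = Min (ends N b)"
      and "Min (ends N b) \<noteq> Max (ends N b)" using doubleton_eq_iff by metis+
    then show "(if ends N b = {j, k} then - admittance N b else 0) =
        admittance N b * incidence N b j * incidence N b k"
      using False by (auto simp: incidence_def)
  qed
  finally show ?thesis .
qed

lemma admittance_matrix_mult_vec:
  fixes N :: "('b, 'a::comm_ring_1) network"
  assumes N: "is_network N" and v: "v \<in> carrier_vec (num_nodes N)" and j: "j < num_nodes N"
  shows "(admittance_matrix N *\<^sub>v v) $ j =
    (\<Sum>b\<in>branches N. admittance N b * incidence N b j * potential_drop N v b)"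
proof -
  let ?n = "num_nodes N" and ?y = "admittance N" and ?d = "incidence N"
  have "(admittance_matrix N *\<^sub>v v) $ j = (\<Sum>k<?n. admittance_matrix N $$ (j, k) * v $ k)"
    using v j admittance_matrix_carrier[of N]
    by (auto simp: scalar_prod_def atLeast0LessThan simp del: admittance_matrix_carrier intro!: sum.cong)
  also have "\<dots> = (\<Sum>k<?n. \<Sum>b\<in>branches N. ?y b * ?d b j * ?d b k * v $ k)"
    using j by (intro sum.cong) (auto simp: admittance_matrix_factorization[OF N] sum_distrib_right)
  also have "\<dots> = (\<Sum>b\<in>branches N. ?y b * ?d b j * (\<Sum>k<?n. ?d b k * v $ k))"
    by (subst sum.swap) (simp add: sum_distrib_left mult.assoc)
  finally show ?thesis by (simp add: sum_incidence[OF N])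
qed

lemma admittance_matrix_energy:
  fixes N :: "('b, 'a::comm_ring_1) network"
  assumes N: "is_network N" and v: "v \<in> carrier_vec (num_nodes N)"
  shows "v \<bullet> (admittance_matrix N *\<^sub>v v) =
    (\<Sum>b\<in>branches N. admittance N b * (potential_drop N v b)\<^sup>2)"
proof -
  let ?n = "num_nodes N" and ?y = "admittance N" and ?d = "incidence N"
  have "v \<bullet> (admittance_matrix N *\<^sub>v v) = (\<Sum>j<?n. v $ j * (admittance_matrix N *\<^sub>v v) $ j)"
    using admittance_matrix_carrier[of N]
    by (auto simp: scalar_prod_def atLeast0LessThan simp del: admittance_matrix_carrier)
  also have "\<dots> = (\<Sum>j<?n. \<Sum>b\<in>branches N. ?y b * potential_drop N v b * (?d b j * v $ j))"
    by (intro sum.cong)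
      (auto simp: admittance_matrix_mult_vec[OF N v] sum_distrib_left ac_simps)
  also have "\<dots> = (\<Sum>b\<in>branches N. ?y b * potential_drop N v b * (\<Sum>j<?n. ?d b j * v $ j))"
    by (subst sum.swap) (simp add: sum_distrib_left)
  finally show ?thesis by (simp add: sum_incidence[OF N] power2_eq_square mult.assoc)
qed


section \<open>The kernel of the admittance matrix\<close>

lemma equiv_connection: "equiv UNIV ((adjacency N)\<^sup>*)"
proof -
  have "sym (adjacency N)" by (auto simp: adjacency_def sym_def insert_commute)
  then show ?thesis by (simp add: equiv_def refl_rtrancl sym_rtrancl trans_rtrancl)
qed

text \<open>
  The relation lives on all natural numbers; it is the identity outside the node set.
\<close>

lemma connection_cases:
  assumes N: "is_network N" and jk: "(j, k) \<in> (adjacency N)\<^sup>*"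
  obtains "j = k" | "j < num_nodes N" "k < num_nodes N"
proof -
  have "p < num_nodes N \<and> q < num_nodes N" if "(p, q) \<in> adjacency N" for p q
    using N that by (fastforce simp: adjacency_def is_network_def)
  with jk show thesis by (metis converse_rtranclE rtrancl.cases that)
qed

lemma potential_drop_zero_iff:
  assumes N: "is_network N"
  shows "(\<forall>b\<in>branches N. potential_drop N v b = 0) \<longleftrightarrow>
    (\<forall>j k. (j, k) \<in> (adjacency N)\<^sup>* \<longrightarrow> v $ j = v $ k)"
proof (intro iffI allI impI ballI)
  fix j k assume drop: "\<forall>b\<in>branches N. potential_drop N v b = 0"
    and "(j, k) \<in> (adjacency N)\<^sup>*"
  from this(2) show "v $ j = v $ k"
  proof induction
    case (step i k)
    then obtain b where b: "b \<in> branches N" "ends N b = {i, k}" by (auto simp: adjacency_def)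
    then have "{Min (ends N b), Max (ends N b)} = {i, k}"
      using ends_Min_Max(1)[OF N] by metis
    moreover have "v $ Min (ends N b) = v $ Max (ends N b)"
      using drop b(1) by (simp add: potential_drop_def)
    ultimately have "v $ i = v $ k" by (auto simp: doubleton_eq_iff)
    with step.IH show ?case by simp
  qed simp
next
  fix b assume const: "\<forall>j k. (j, k) \<in> (adjacency N)\<^sup>* \<longrightarrow> v $ j = v $ k"
    and b: "b \<in> branches N"
  have "(Min (ends N b), Max (ends N b)) \<in> adjacency N"
    using ends_Min_Max(1)[OF N b] b by (auto simp: adjacency_def)
  then show "potential_drop N v b = 0"
    using const by (auto simp: potential_drop_def)
qed

lemma componentwise_constant_in_kernel:
  fixes N :: "('b, 'a::comm_ring_1) network"
  assumes N: "is_network N" and v: "v \<in> carrier_vec (num_nodes N)"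
    and const: "\<And>j k. (j, k) \<in> (adjacency N)\<^sup>* \<Longrightarrow> v $ j = v $ k"
  shows "admittance_matrix N *\<^sub>v v = 0\<^sub>v (num_nodes N)"
proof (rule eq_vecI)
  fix j assume "j < dim_vec (0\<^sub>v (num_nodes N) :: 'a vec)"
  moreover have "\<forall>b\<in>branches N. potential_drop N v b = 0"
    using const potential_drop_zero_iff[OF N] by blast
  ultimately show "(admittance_matrix N *\<^sub>v v) $ j = 0\<^sub>v (num_nodes N) $ j"
    by (simp add: admittance_matrix_mult_vec[OF N v])
qed (simp add: admittance_matrix_def)

text \<open>
  The energy is a sum of nonnegative terms, so each term vanishes, and with it each drop. The
  inequality in the assumption, rather than an equation, is what positive definiteness of the
  grounded matrix calls for.
\<close>

lemma zero_energy_imp_componentwise_constant: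
  fixes N :: "('b, real) network"
  assumes N: "is_network N" and pos: "\<And>b. b \<in> branches N \<Longrightarrow> admittance N b > 0"
    and v: "v \<in> carrier_vec (num_nodes N)"
    and energy: "v \<bullet> (admittance_matrix N *\<^sub>v v) \<le> 0"
    and jk: "(j, k) \<in> (adjacency N)\<^sup>*"
  shows "v $ j = v $ k"
proof -
  let ?p = "\<lambda>b. admittance N b * (potential_drop N v b)\<^sup>2"
  have fin: "finite (branches N)" using N by (simp add: is_network_def)
  have nonneg: "?p b \<ge> 0" if "b \<in> branches N" for b using pos[OF that] by simp
  have "sum ?p (branches N) = 0"
    using energy sum_nonneg[of "branches N" ?p] nonneg
    by (simp add: admittance_matrix_energy[OF N v])
  then have "\<forall>b\<in>branches N. ?p b = 0"
    using sum_nonneg_eq_0_iff[of "branches N" ?p] fin nonneg by simp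
  then have "\<forall>b\<in>branches N. potential_drop N v b = 0" using pos by fastforce
  then show ?thesis using potential_drop_zero_iff[OF N] jk by blast
qed

text \<open>
  For a network whose admittances happen to be real, this is the same network with
  the admittances read as elements of \<open>\<real>\<close>.
\<close>

definition real_network :: "('b, 'a::real_normed_field) network \<Rightarrow> ('b, real) network" where
  "real_network N = \<lparr>num_nodes = num_nodes N, branches = branches N, ends = ends N,
     admittance = (\<lambda>b. SOME y. admittance N b = of_real y)\<rparr>"

lemma real_network_simps [simp]:
  "num_nodes (real_network N) = num_nodes N" "branches (real_network N) = branches N"
  "is_network (real_network N) = is_network N" "adjacency (real_network N) = adjacency N"
  by (simp_all add: real_network_def is_network_def adjacency_def)

lemma of_real_admittance_real_network:
  assumes "admittance N b \<in> of_real ` Y"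
  shows "of_real (admittance (real_network N) b) = admittance N b"
    and "admittance (real_network N) b \<in> Y"
proof -
  from assms obtain y where y: "admittance N b = of_real y" "y \<in> Y" by blast
  then show "of_real (admittance (real_network N) b) = admittance N b"
    and "admittance (real_network N) b \<in> Y" by (simp_all add: real_network_def)
qed

lemma admittance_matrix_real_network:
  assumes "\<And>b. b \<in> branches N \<Longrightarrow> admittance N b \<in> of_real ` Y"
  shows "admittance_matrix N = map_mat of_real (admittance_matrix (real_network N))"
proof (rule eq_matI)
  fix i j assume "i < dim_row (map_mat of_real (admittance_matrix (real_network N)))"
    "j < dim_col (map_mat of_real (admittance_matrix (real_network N)))"
  then show "admittance_matrix N $$ (i, j) =
      map_mat of_real (admittance_matrix (real_network N)) $$ (i, j)"
    using of_real_admittance_real_network(1)[OF assms]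
    by (auto simp: admittance_matrix_def of_real_sum real_network_def intro!: sum.cong)
qed (simp_all add: admittance_matrix_def)

text \<open>
  A real normed field comes with neither an order nor a conjugation, so a sum of squares in it says
  nothing about its terms. Functionals that separate points give access to the real case.
\<close>

lemma real_functional_separates:
  fixes x :: "'a::real_vector"
  assumes "x \<noteq> 0"
  obtains f :: "'a \<Rightarrow> real" where "linear f" "f x \<noteq> 0"
proof -
  have "independent {x}" using assms by simp
  then obtain f :: "'a \<Rightarrow> real" where "linear f" "f x = 1"
    using linear_independent_extend[of "{x}" "\<lambda>_. 1"] by auto
  then show thesis by (intro that) auto
qed

text \<open>
  A functional \<open>f\<close> commutes with the real matrix \<open>Y\<close>, so it maps a kernel vector entrywise
  to a real kernel vector, for which the energy argument applies. If the kernel vector took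
  different values at \<open>j\<close> and \<open>k\<close>, some \<open>f\<close> would tell them apart.
\<close>

lemma kernel_componentwise_constant:
  fixes N :: "('b, 'a::real_normed_field) network"
  assumes N: "is_network N"
    and pos: "\<And>b. b \<in> branches N \<Longrightarrow> admittance N b \<in> of_real ` {0<..}"
    and v: "v \<in> carrier_vec (num_nodes N)"
    and ker: "admittance_matrix N *\<^sub>v v = 0\<^sub>v (num_nodes N)"
    and jk: "(j, k) \<in> (adjacency N)\<^sup>*" "j < num_nodes N" "k < num_nodes N"
  shows "v $ j = v $ k"
proof (rule ccontr)
  let ?n = "num_nodes N" and ?L = "admittance_matrix (real_network N)"
  assume "v $ j \<noteq> v $ k"
  then obtain f :: "'a \<Rightarrow> real" where f: "linear f" and sep: "f (v $ j - v $ k) \<noteq> 0"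
    using real_functional_separates[of "v $ j - v $ k"] by auto
  interpret f: linear f by (rule f)
  let ?w = "map_vec f v"
  have w: "?w \<in> carrier_vec (num_nodes (real_network N))" using v by simp
  have L: "?L \<in> carrier_mat ?n ?n" by (simp add: admittance_matrix_def)
  have "?L *\<^sub>v ?w = 0\<^sub>v ?n"
  proof (rule eq_vecI)
    fix i assume "i < dim_vec (0\<^sub>v ?n :: real vec)"
    then have i: "i < ?n" by simp
    have "0 = f ((admittance_matrix N *\<^sub>v v) $ i)" using ker i by (simp add: f.zero)
    also have "\<dots> = f (\<Sum>c<?n. ?L $$ (i, c) *\<^sub>R v $ c)"
      using L v i by (simp add: admittance_matrix_real_network[OF pos] scalar_prod_def
          atLeast0LessThan scaleR_conv_of_real)
    also have "\<dots> = (?L *\<^sub>v ?w) $ i"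
      using L v i by (simp add: f.sum f.scaleR scalar_prod_def atLeast0LessThan)
    finally show "(?L *\<^sub>v ?w) $ i = 0\<^sub>v ?n $ i" using i by simp
  qed (use L in simp)
  then have "?w \<bullet> (?L *\<^sub>v ?w) \<le> 0" using v by simp
  then have "?w $ j = ?w $ k"
    using zero_energy_imp_componentwise_constant[OF _ _ w] N jk(1)
      of_real_admittance_real_network(2)[OF pos] by auto
  then show False using sep jk v by (simp add: f.diff)
qed

section \<open>The rank\<close>

definition representative :: "('b, 'a) network \<Rightarrow> nat \<Rightarrow> nat" where
  "representative N j = (LEAST i. (j, i) \<in> (adjacency N)\<^sup>*)"

lemma representative_connected: "(j, representative N j) \<in> (adjacency N)\<^sup>*"
  unfolding representative_def by (rule LeastI[of _ j]) simp

lemma representative_le: "representative N j \<le> j"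
  unfolding representative_def by (rule Least_le) simp

lemma representative_cong:
  assumes "(j, k) \<in> (adjacency N)\<^sup>*"
  shows "representative N j = representative N k"
proof -
  have "(j, i) \<in> (adjacency N)\<^sup>* \<longleftrightarrow> (k, i) \<in> (adjacency N)\<^sup>*" for i
    using equiv_class_eq[OF equiv_connection assms] by blast
  then show ?thesis by (simp add: representative_def)
qed

lemma representative_idem [simp]:
  "representative N (representative N j) = representative N j"
  using representative_cong[OF representative_connected] by metis

text \<open>
  The map from a node to its component is injective on representatives, and already these reach every
  component.
\<close>

lemma card_representatives:
  "card (representative N ` {..<num_nodes N}) = card (components N)"
proof -
  let ?E = "(adjacency N)\<^sup>*"
  have "components N = (\<lambda>r. ?E `` {r}) ` representative N ` {..<num_nodes N}"
    using equiv_class_eq[OF equiv_connection representative_connected]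
    by (auto simp: components_def quotient_def image_image)
  moreover have "inj_on (\<lambda>r. ?E `` {r}) (representative N ` {..<num_nodes N})"
  proof (rule inj_onI)
    fix r s assume rs: "r \<in> representative N ` {..<num_nodes N}"
      "s \<in> representative N ` {..<num_nodes N}" and "?E `` {r} = ?E `` {s}"
    then have "(r, s) \<in> ?E" using eq_equiv_class[OF _ equiv_connection] by blast
    then have "representative N r = representative N s" by (rule representative_cong)
    then show "r = s" using rs by auto
  qed
  ultimately show ?thesis by (simp add: card_image)
qed

text \<open>
  The columns to be selected are those of the nodes that do not represent their component. The
  upper bound holds for arbitrary admittances because the componentwise constant vectors are
  always in the kernel; positivity makes them the whole kernel, and one that vanishes at all
  representatives is \<open>0\<close>.
\<close>

lemma rank_admittance_matrix:
  fixes N :: "('b, 'a::real_normed_field) network"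
  assumes N: "is_network N"
  shows "vec_space.rank (num_nodes N) (admittance_matrix N)
      \<le> num_nodes N - card (components N)"
    and "(\<And>b. b \<in> branches N \<Longrightarrow> admittance N b \<in> of_real ` {0<..}) \<Longrightarrow>
      vec_space.rank (num_nodes N) (admittance_matrix N)
      = num_nodes N - card (components N)"
proof -
  let ?n = "num_nodes N" and ?Y = "admittance_matrix N" and ?r = "representative N"
  define S where "S = {..<?n} - ?r ` {..<?n}"
  have S: "S \<subseteq> {..<?n}" by (auto simp: S_def)
  have r: "?r j < ?n" if "j < ?n" for j using representative_le[of N j] that by simp
  then have "?r ` {..<?n} \<subseteq> {..<?n}" by auto
  then have card: "card S = ?n - card (components N)"
    by (simp add: S_def card_Diff_subset card_representatives)
  have spanning: "\<exists>u\<in>carrier_vec ?n. (\<forall>i<?n. i \<notin> S \<longrightarrow> u $ i = 0) \<and> ?Y *\<^sub>v u = ?Y *\<^sub>v v"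
    if v: "v \<in> carrier_vec ?n" for v :: "'a vec"
  proof (intro bexI conjI allI impI)
    \<comment> \<open>Shifting \<open>v\<close> by a constant on each component makes it vanish at the representatives.\<close>
    let ?c = "vec ?n (\<lambda>j. v $ ?r j)"
    have "?Y *\<^sub>v ?c = 0\<^sub>v ?n"
    proof (rule componentwise_constant_in_kernel[OF N])
      fix j k assume jk: "(j, k) \<in> (adjacency N)\<^sup>*"
      from N jk show "?c $ j = ?c $ k"
        by (cases rule: connection_cases) (auto simp: representative_cong[OF jk])
    qed simp
    then show "?Y *\<^sub>v (v - ?c) = ?Y *\<^sub>v v"
      using v admittance_matrix_carrier[of N]
      by (simp add: mult_minus_distrib_mat_vec[of _ ?n ?n] del: admittance_matrix_carrier)
    show "(v - ?c) $ i = 0" if "i < ?n" "i \<notin> S" for i using that v by (auto simp: S_def)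
  qed (use v in simp)
  show "vec_space.rank ?n ?Y \<le> ?n - card (components N)"
    unfolding card[symmetric]
    by (rule vec_space.rank_column_selection(1)[OF admittance_matrix_carrier S spanning])
  show "vec_space.rank ?n ?Y = ?n - card (components N)"
    if pos: "\<And>b. b \<in> branches N \<Longrightarrow> admittance N b \<in> of_real ` {0<..}"
    unfolding card[symmetric]
  proof (rule vec_space.rank_column_selection(2)[OF admittance_matrix_carrier S spanning])
    fix u assume u: "u \<in> carrier_vec ?n" "\<And>i. i < ?n \<Longrightarrow> i \<notin> S \<Longrightarrow> u $ i = 0"
      and ker: "?Y *\<^sub>v u = 0\<^sub>v ?n"
    show "u = 0\<^sub>v ?n"
    proof (rule eq_vecI)
      fix i assume "i < dim_vec (0\<^sub>v ?n :: 'a vec)"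
      then have i: "i < ?n" by simp
      have "u $ i = u $ ?r i"
        by (rule kernel_componentwise_constant[OF N pos u(1) ker representative_connected i r[OF i]])
      also have "\<dots> = 0" using i by (intro u(2) r) (auto simp: S_def)
      finally show "u $ i = 0\<^sub>v ?n $ i" using i by simp
    qed (use u(1) in simp)
  qed
qed

section \<open>The common cofactor\<close>

text \<open>
  The matrix with row and column \<open>0\<close> deleted acts like the full matrix on potentials with value \<open>0\<close>
  at node \<open>0\<close>, except that the equation at node \<open>0\<close> is dropped.
\<close>

lemma grounded_mult_vec:
  fixes A :: "'a::comm_ring_1 mat"
  assumes A: "A \<in> carrier_mat (Suc m) (Suc m)" and w: "w \<in> carrier_vec m" and i: "i < m"
  shows "(mat_delete A 0 0 *\<^sub>v w) $ i = (A *\<^sub>v vCons 0 w) $ Suc i"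
proof -
  have "(A *\<^sub>v vCons 0 w) $ Suc i = (\<Sum>k<Suc m. A $$ (Suc i, k) * vCons 0 w $ k)"
    using A w i by (simp add: scalar_prod_def atLeast0LessThan)
  also have "\<dots> = (\<Sum>k<m. A $$ (Suc i, Suc k) * w $ k)"
    by (simp only: sum.lessThan_Suc_shift) simp
  also have "\<dots> = (mat_delete A 0 0 *\<^sub>v w) $ i"
    using A w i by (simp add: scalar_prod_def atLeast0LessThan mat_delete_def)
  finally show ?thesis by simp
qed

text \<open>
  The potential \<open>0\<close> on the component of node \<open>0\<close> and \<open>1\<close> elsewhere is in the kernel, and it stays nonzero
  after its entry at node \<open>0\<close> is removed.
\<close>

lemma common_cofactor_zero_if_disconnected:
  fixes N :: "('b, 'a::idom) network"
  assumes N: "is_network N" and dis: "\<not> connected_network N"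
  shows "common_cofactor (admittance_matrix N) = 0"
proof -
  let ?Y = "admittance_matrix N" and ?E = "(adjacency N)\<^sup>*"
  obtain p q where pq: "p < num_nodes N" "q < num_nodes N" "(p, q) \<notin> ?E"
    using dis by (auto simp: connected_network_def)
  then obtain m where m: "num_nodes N = Suc m" by (cases "num_nodes N") auto
  have sym: "sym ?E" and trans: "trans ?E"
    using equiv_connection[of N] by (auto simp: equiv_def)
  obtain s where s: "s < Suc m" "(0, s) \<notin> ?E"
    using pq m sym trans by (metis symD transD)
  \<comment> \<open>Index \<open>i\<close> of \<open>w\<close> stands for node \<open>Suc i\<close>; node \<open>0\<close> is grounded.\<close>
  define w :: "'a vec" where "w = vec m (\<lambda>i. if (0, Suc i) \<in> ?E then 0 else 1)"
  have w: "w \<in> carrier_vec m" by (simp add: w_def)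
  have v: "vCons 0 w $ j = (if (0, j) \<in> ?E then 0 else 1)" if "j < Suc m" for j
    using that by (cases j) (auto simp: w_def)
  have M: "mat_delete ?Y 0 0 \<in> carrier_mat m m"
    using mat_delete_carrier[of ?Y "Suc m" "Suc m" 0 0] admittance_matrix_carrier[of N] m by simp
  have "?Y *\<^sub>v vCons 0 w = 0\<^sub>v (Suc m)"
    unfolding m[symmetric]
  proof (rule componentwise_constant_in_kernel[OF N])
    show "vCons 0 w \<in> carrier_vec (num_nodes N)" using w m by simp
    fix j k assume jk: "(j, k) \<in> ?E"
    then have "(0, j) \<in> ?E \<longleftrightarrow> (0, k) \<in> ?E" using sym trans by (meson symD transD)
    with N jk show "vCons 0 w $ j = vCons 0 w $ k"
      by (cases rule: connection_cases) (auto simp: v m)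
  qed
  then have "mat_delete ?Y 0 0 *\<^sub>v w = 0\<^sub>v m"
    using grounded_mult_vec[of ?Y m w] admittance_matrix_carrier[of N] M w m
    by (intro eq_vecI) auto
  moreover obtain i where "s = Suc i" using s(2) by (cases s) auto
  then have "i < m" "w $ i = 1" using s by (auto simp: w_def)
  then have "w \<noteq> 0\<^sub>v m" by auto
  ultimately have "det (mat_delete ?Y 0 0) = 0"
    using det_0_iff_vec_prod_zero[OF M] w by blast
  then have "cofactor ?Y 0 0 = 0" by (simp add: cofactor_def)
  then show ?thesis using common_cofactor_eq[OF N, of 0 0] m by simp
qed

text \<open>
  The quadratic form of the grounded matrix is the energy of the potential extended by \<open>0\<close> at node
  \<open>0\<close>. If it is not positive, then the potential is constant by connectedness, hence \<open>0\<close>.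
\<close>

lemma grounded_det_pos:
  fixes N :: "('b, real) network"
  assumes N: "is_network N" and conn: "connected_network N" and n: "num_nodes N > 0"
    and pos: "\<And>b. b \<in> branches N \<Longrightarrow> admittance N b > 0"
  shows "det (mat_delete (admittance_matrix N) 0 0) > 0"
proof -
  let ?Y = "admittance_matrix N"
  obtain m where m: "num_nodes N = Suc m" using n by (cases "num_nodes N") auto
  have Y: "?Y \<in> carrier_mat (Suc m) (Suc m)" using admittance_matrix_carrier[of N] m by simp
  show ?thesis
  proof (rule posdef_det_pos)
    show M: "mat_delete ?Y 0 0 \<in> carrier_mat m m" using mat_delete_carrier[OF Y] by simp
    fix w :: "real vec" assume w: "w \<in> carrier_vec m" "w \<noteq> 0\<^sub>v m"
    let ?v = "vCons 0 w"
    have energy: "?v \<bullet> (?Y *\<^sub>v ?v) = w \<bullet> (mat_delete ?Y 0 0 *\<^sub>v w)"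
    proof -
      have "?v \<bullet> (?Y *\<^sub>v ?v) = (\<Sum>k<Suc m. ?v $ k * (?Y *\<^sub>v ?v) $ k)"
        using Y by (simp add: scalar_prod_def atLeast0LessThan)
      also have "\<dots> = (\<Sum>k<m. w $ k * (?Y *\<^sub>v ?v) $ Suc k)"
        by (simp only: sum.lessThan_Suc_shift) simp
      also have "\<dots> = w \<bullet> (mat_delete ?Y 0 0 *\<^sub>v w)"
        using Y grounded_mult_vec[OF Y w(1)]
        by (simp add: scalar_prod_def[of w] atLeast0LessThan del: index_mult_mat_vec)
      finally show ?thesis .
    qed
    show "w \<bullet> (mat_delete ?Y 0 0 *\<^sub>v w) > 0"
    proof (rule ccontr)
      assume "\<not> ?thesis"
      then have le: "?v \<bullet> (?Y *\<^sub>v ?v) \<le> 0" using energy by simp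
      have v: "?v \<in> carrier_vec (num_nodes N)" using w m by simp
      have "w $ i = 0" if "i < m" for i
      proof -
        have "(Suc i, 0) \<in> (adjacency N)\<^sup>*"
          using conn m that by (simp add: connected_network_def)
        from zero_energy_imp_componentwise_constant[OF N pos v le this]
        show ?thesis by simp
      qed
      then have "w = 0\<^sub>v m" using w(1) by (intro eq_vecI) auto
      with w(2) show False by contradiction
    qed
  qed
qed

lemma common_cofactor_pos:
  fixes N :: "('b, 'a::real_normed_field) network"
  assumes N: "is_network N" and conn: "connected_network N" and n: "num_nodes N > 0"
    and pos: "\<And>b. b \<in> branches N \<Longrightarrow> admittance N b \<in> of_real ` {0<..}"
  shows "common_cofactor (admittance_matrix N) \<in> of_real ` {0<..}"
proof -
  let ?L = "admittance_matrix (real_network N)"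
  have L: "admittance_matrix N = map_mat of_real ?L"
    by (rule admittance_matrix_real_network[OF pos])
  have "common_cofactor (admittance_matrix N) = cofactor (admittance_matrix N) 0 0"
    by (rule common_cofactor_eq[OF N n n, symmetric])
  also have "\<dots> = det (mat_delete (map_mat of_real ?L) 0 0)"
    by (simp only: cofactor_def L add_0 power_0 mult_1)
  also have "mat_delete (map_mat of_real ?L) 0 0 = (map_mat of_real (mat_delete ?L 0 0) :: 'a mat)"
    by (rule eq_matI) (auto simp: mat_delete_def)
  also have "det \<dots> = of_real (det (mat_delete ?L 0 0))"
    by (rule of_real_hom.hom_det)
  finally have "common_cofactor (admittance_matrix N) = of_real (det (mat_delete ?L 0 0))" .
  moreover have "det (mat_delete ?L 0 0) > 0"
  proof (rule grounded_det_pos)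
    show "admittance (real_network N) b > 0" if "b \<in> branches (real_network N)" for b
      using of_real_admittance_real_network(2)[OF pos] that by simp
  qed (use N conn n in \<open>simp_all add: connected_network_def\<close>)
  ultimately show ?thesis by blast
qed

section \<open>Deleting branches of zero admittance\<close>

lemma delete_zero_simps [simp]:
  "num_nodes (delete_zero N) = num_nodes N" "ends (delete_zero N) = ends N"
  "admittance (delete_zero N) = admittance N"
  by (simp_all add: delete_zero_def)

lemma is_network_delete_zero: "is_network N \<Longrightarrow> is_network (delete_zero N)"
  by (simp add: is_network_def delete_zero_def)

lemma admittance_matrix_delete_zero:
  assumes "is_network N"
  shows "admittance_matrix (delete_zero N) = admittance_matrix N"
proof -
  have fin: "finite (branches N)" using assms by (simp add: is_network_def)
  have "(\<Sum>b | b \<in> branches (delete_zero N) \<and> P b. admittance N b) =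
      (\<Sum>b | b \<in> branches N \<and> P b. admittance N b)" for P
    by (rule sum.mono_neutral_left) (use fin in \<open>auto simp: delete_zero_def\<close>)
  then show ?thesis by (intro eq_matI) (simp_all add: admittance_matrix_def)
qed

lemma card_components_connected:
  assumes "connected_network N" and "num_nodes N > 0"
  shows "card (components N) = 1"
proof -
  have "representative N j = representative N 0" if "j \<in> {..<num_nodes N}" for j
    by (rule representative_cong) (use assms that in \<open>simp add: connected_network_def\<close>)
  then have "representative N ` {..<num_nodes N} = (\<lambda>_. representative N 0) ` {..<num_nodes N}"
    by (rule image_cong[OF refl])
  also have "\<dots> = {representative N 0}" using assms(2) by auto
  finally show ?thesis using card_representatives[of N] by simp
qed

theorem proposition22:
  fixes N :: "('b, 'a::real_normed_field) network" and n :: nat and Y :: "'a mat"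
  assumes "is_network N"
    and "n = num_nodes N" and "n \<ge> 2"
    and "Y = admittance_matrix N"
  shows "(connected_network N \<longrightarrow>
          (\<forall>b\<in>branches N. admittance N b \<in> of_real ` {0..}) \<longrightarrow>
          connected_network (delete_zero N) \<longrightarrow>
            common_cofactor Y \<in> of_real ` {0<..} \<and> vec_space.rank n Y = n - 1) \<and>
         (\<forall>k. card (components (delete_zero N)) = k \<longrightarrow>
            vec_space.rank n Y \<le> n - k \<and> (k > 1 \<longrightarrow> common_cofactor Y = 0)) \<and>
         (\<forall>k. card (components (delete_zero N)) = k \<longrightarrow>
            (\<forall>b\<in>branches (delete_zero N). admittance (delete_zero N) b \<in> of_real ` {0<..}) \<longrightarrow>
            vec_space.rank n Y = n - k)"
proof -
  let ?M = "delete_zero N"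
  have M: "is_network ?M" using assms(1) by (rule is_network_delete_zero)
  have n: "num_nodes ?M = n" by (simp add: assms(2))
  have Y: "admittance_matrix ?M = Y" using assms by (simp add: admittance_matrix_delete_zero)
  note rank = rank_admittance_matrix[OF M, unfolded n Y]
  have 1: "common_cofactor Y \<in> of_real ` {0<..} \<and> vec_space.rank n Y = n - 1"
    if "\<forall>b\<in>branches N. admittance N b \<in> of_real ` {0..}" and conn: "connected_network ?M"
  proof
    have pos: "admittance ?M b \<in> of_real ` {0<..}" if "b \<in> branches ?M" for b
      using that \<open>\<forall>b\<in>branches N. _ b\<close> by (fastforce simp: delete_zero_def less_le)
    show "common_cofactor Y \<in> of_real ` {0<..}"
      using common_cofactor_pos[OF M conn _ pos] assms(2,3) by (simp add: Y)
    show "vec_space.rank n Y = n - 1"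
      using rank(2)[OF pos] card_components_connected[OF conn] assms(2,3) by simp
  qed
  have 2: "common_cofactor Y = 0" if "card (components ?M) > 1"
  proof -
    have "\<not> connected_network ?M"
      using that card_components_connected[of ?M] assms(2,3) by auto
    then show ?thesis using common_cofactor_zero_if_disconnected[OF M] by (simp add: Y)
  qed
  show ?thesis
  proof (intro conjI allI impI)
    fix k assume k: "card (components ?M) = k"
    show "vec_space.rank n Y \<le> n - k" using rank(1) k by simp
    show "common_cofactor Y = 0" if "k > 1" using 2 k that by simp
    assume "\<forall>b\<in>branches ?M. admittance ?M b \<in> of_real ` {0<..}"
    then show "vec_space.rank n Y = n - k" using rank(2) k by blast
  qed (use 1 in blast)+
qed

end
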